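(* The class of $\omega$-languages recognized by deterministic strong reset Parikh automata is not closed under union, not closed under intersection, and not closed under complement. (That is, for each of these operations there is a finite alphabet $\Sigma$ and $\omega$-languages over $\Sigma$ in the class such that the result of applying the operation, with complement taken relative to $\Sigma^\omega$, is not in the class.)
   Context: $\mathbb{N}=\{0,1,2,\dots\}$. A linear set is a set $C(\mathbf{b},P)=\{\mathbf{b}+\mathbf{p}_1z_1+\dots+\mathbf{p}_\ell z_\ell \mid z_1,\dots,z_\ell\in\mathbb{N}\}\subseteq\mathbb{N}^d$ with $\mathbf{b}\in\mathbb{N}^d$ and $P=\{\mathbf{p}_1,\dots,\mathbf{p}_\ell\}\subseteq\mathbb{N}^d$ finite ($\ell\ge 0$); a semi-linear set is a finite union of linear sets. A Parikh automaton (PA) of dimension $d\ge 1$ is a tuple $\mathcal{A}=(Q,\Sigma,q_0,\Delta,F,C)$ with a finite state set $Q$, a finite non-empty alphabet $\Sigma$, an initial state $q_0\in Q$, a finite set of labeled transitions $\Delta\subseteq Q\times\Sigma\times\mathbb{N}^d\times Q$, a set of accepting states $F\subseteq Q$, and a semi-linear set $C\subseteq\mathbb{N}^d$. It is deterministic if for every $(p,a)\in Q\times\Sigma$ there is exactly one transition $(p,a,\mathbf{v},q)\in\Delta$. A run on $\alpha=\alpha_1\alpha_2\dots\in\Sigma^\omega$ is an infinite sequence $r=r_1r_2\dots$ with $r_i=(p_{i-1},\alpha_i,\mathbf{v}_i,p_i)\in\Delta$ and $p_0=q_0$; write $\rho(r_m\dots r_n)=\sum_{i=m}^n\mathbf{v}_i$.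 A strong reset PA is a PA with the following acceptance: let $k_0=0$ and let $k_1<k_2<\dots$ be all positions $k\ge 1$ with $p_k\in F$. Then $r$ is accepting iff this sequence is infinite and $\rho(r_{k_{i-1}+1}\dots r_{k_i})\in C$ for all $i\ge 1$. The recognized $\omega$-language is the set of all $\alpha\in\Sigma^\omega$ on which there is an accepting run. *)

theory Defs
  imports "HOL-Library.Omega_Words_Fun"
begin

text \<open>
  The dimension varies with the automaton, so a vector in \<open>\<nat>\<^sup>d\<close> is a function on \<^typ>\<open>nat\<close>
  that vanishes from index \<open>d\<close> on; the padding makes equality of functions agree with
  equality of vectors.
\<close>

type_synonym natvec = "nat \<Rightarrow> nat"

definition natvecs :: "nat \<Rightarrow> natvec set" where
  "natvecs d = {v. \<forall>i\<ge>d. v i = 0}"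

definition linear_set :: "natvec \<Rightarrow> natvec set \<Rightarrow> natvec set" where
  "linear_set b P = {(\<lambda>i. b i + (\<Sum>p\<in>P. p i * z p)) | z :: natvec \<Rightarrow> nat. True}"

definition semilinear :: "nat \<Rightarrow> natvec set \<Rightarrow> bool" where
  "semilinear d C \<longleftrightarrow>
    (\<exists>B. finite B \<and> (\<forall>(b, P)\<in>B. b \<in> natvecs d \<and> finite P \<and> P \<subseteq> natvecs d) \<and>
         C = (\<Union>(b, P)\<in>B. linear_set b P))"

record ('q, 'a) pa =
  pa_dim :: nat
  pa_states :: "'q set"
  pa_alphabet :: "'a set"
  pa_init :: 'q
  pa_trans :: "('q \<times> 'a \<times> natvec \<times> 'q) set"
  pa_final :: "'q set"
  pa_constraint :: "natvec set"

definition parikh_automaton :: "('q, 'a) pa \<Rightarrow> bool" where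
  "parikh_automaton A \<longleftrightarrow>
     pa_dim A \<ge> 1 \<and>
     finite (pa_states A) \<and>
     finite (pa_alphabet A) \<and> pa_alphabet A \<noteq> {} \<and>
     pa_init A \<in> pa_states A \<and>
     finite (pa_trans A) \<and>
     pa_trans A \<subseteq> pa_states A \<times> pa_alphabet A \<times> natvecs (pa_dim A) \<times> pa_states A \<and>
     pa_final A \<subseteq> pa_states A \<and>
     semilinear (pa_dim A) (pa_constraint A)"

definition pa_deterministic :: "('q, 'a) pa \<Rightarrow> bool" where
  "pa_deterministic A \<longleftrightarrow>
     (\<forall>p\<in>pa_states A. \<forall>a\<in>pa_alphabet A.
        \<exists>!t. t \<in> pa_trans A \<and> (\<exists>v q. t = (p, a, v, q)))"

text \<open>
  A run is given by its state sequence \<open>p\<^sub>0, p\<^sub>1, \<dots>\<close> and its vector sequence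
  \<open>v\<^sub>1, v\<^sub>2, \<dots>\<close>. As words are indexed from 0, \<open>\<alpha> i\<close> and \<open>v i\<close> are the letter and the
  vector of transition number \<open>i + 1\<close>, which leads from \<open>p i\<close> to \<open>p (Suc i)\<close>.
\<close>

definition pa_run :: "('q, 'a) pa \<Rightarrow> 'a word \<Rightarrow> 'q word \<Rightarrow> natvec word \<Rightarrow> bool" where
  "pa_run A \<alpha> p v \<longleftrightarrow> p 0 = pa_init A \<and> (\<forall>i. (p i, \<alpha> i, v i, p (Suc i)) \<in> pa_trans A)"

text \<open>
  The sum of the vectors of the transitions numbered \<open>m + 1, \<dots>, n\<close>, counted from 1.
\<close>

definition segment_sum :: "natvec word \<Rightarrow> nat \<Rightarrow> nat \<Rightarrow> natvec" where
  "segment_sum v m n = (\<lambda>j. \<Sum>i=m..<n. v i j)"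

definition final_positions :: "('q, 'a) pa \<Rightarrow> 'q word \<Rightarrow> nat set" where
  "final_positions A p = {k. k \<ge> 1 \<and> p k \<in> pa_final A}"

text \<open>
  The positions \<open>k\<^sub>0 = 0 < k\<^sub>1 < k\<^sub>2 < \<dots>\<close>; only meaningful if there are infinitely many final
  positions, as \<^const>\<open>enumerate\<close> lists infinite sets.
\<close>

definition reset_position :: "('q, 'a) pa \<Rightarrow> 'q word \<Rightarrow> nat \<Rightarrow> nat" where
  "reset_position A p i = (case i of 0 \<Rightarrow> 0 | Suc j \<Rightarrow> enumerate (final_positions A p) j)"

definition strong_reset_accepting :: "('q, 'a) pa \<Rightarrow> 'q word \<Rightarrow> natvec word \<Rightarrow> bool" where
  "strong_reset_accepting A p v \<longleftrightarrow>
     infinite (final_positions A p) \<and>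
     (\<forall>i\<ge>1. segment_sum v (reset_position A p (i - 1)) (reset_position A p i)
              \<in> pa_constraint A)"

definition omega_words :: "'a set \<Rightarrow> 'a word set" where
  "omega_words \<Sigma> = {\<alpha>. range \<alpha> \<subseteq> \<Sigma>}"

definition strong_reset_language :: "('q, 'a) pa \<Rightarrow> 'a word set" where
  "strong_reset_language A =
     {\<alpha> \<in> omega_words (pa_alphabet A).
        \<exists>p v. pa_run A \<alpha> p v \<and> strong_reset_accepting A p v}"

text \<open>
  The class of languages over \<open>\<Sigma>\<close>. State sets are finite, so taking the states from \<^typ>\<open>nat\<close>
  loses no automaton up to renaming of states.
\<close>

definition det_strong_reset_languages :: "'a set \<Rightarrow> 'a word set set" where
  "det_strong_reset_languages \<Sigma> =
     {strong_reset_language A | A :: (nat, 'a) pa.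
        parikh_automaton A \<and> pa_deterministic A \<and> pa_alphabet A = \<Sigma>}"

end

theory Submission
  imports Defs
begin

text \<open>
  At a reset a deterministic automaton remembers nothing but its state. Hence for a language \<open>L\<close> in
  the class, the residuals of \<open>L\<close> by the prefixes at which accepting runs reset form a finite set,
  and every word of \<open>L\<close> has infinitely many such prefixes.

  Let \<open>B\<^sub>x\<close> be the words containing \<open>x\<close> in which every maximal block of letters \<open>x\<close> is followed by a block of the
  other letter of the same length. It is in the class, with resets at the first letter of each block
  of \<open>x\<close>. If \<open>0\<^sup>\<omega>\<close> is in \<open>L\<close>, then \<open>0\<^sup>i\<close> and \<open>0\<^sup>j\<close> have the same residual for some \<open>i \<noteq> j\<close>, so \<open>L\<close>
  cannot decide \<open>m = n\<close> on the words \<open>0\<^sup>m 1\<^sup>n (01)\<^sup>\<omega>\<close>; but both \<open>{0\<^sup>\<omega>} \<union> B\<^sub>0\<close> and the complement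
  of \<open>B\<^sub>0\<close> contain \<open>0\<^sup>\<omega>\<close> and decide it. The intersection of \<open>B\<^sub>0\<close> and \<open>B\<^sub>1\<close> contains all
  \<open>(0\<^sup>n 1\<^sup>n)\<^sup>\<omega>\<close>; two of these with different \<open>n\<close> could be spliced together at resets with equal
  residuals.
\<close>

section \<open>Residuals of deterministic strong reset languages\<close>

text \<open>Index-free counterpart of two neighbouring reset positions: cutting or shifting a run
  moves such pairs along with it, whereas their numbers in the enumeration would change. Position 0
  may be a left end even if its state is not final, matching \<open>k_0 = 0\<close>.\<close>

definition consecutive_resets :: "('q, 'a) pa \<Rightarrow> 'q word \<Rightarrow> nat \<Rightarrow> nat \<Rightarrow> bool" where
  "consecutive_resets A p k k' \<longleftrightarrow>
     k < k' \<and> (k = 0 \<or> p k \<in> pa_final A) \<and> p k' \<in> pa_final A \<and>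
     (\<forall>j. k < j \<and> j < k' \<longrightarrow> p j \<notin> pa_final A)"

lemma consecutive_resets_reset_position:
  assumes "infinite (final_positions A p)"
  shows "consecutive_resets A p (reset_position A p i) (reset_position A p (Suc i))"
proof (cases i)
  case 0
  have "p j \<notin> pa_final A" if "0 < j" "j < enumerate (final_positions A p) 0" for j
    using that not_less_Least[of j "\<lambda>n. n \<in> final_positions A p"]
    by (auto simp: enumerate_0 final_positions_def)
  then show ?thesis
    using enumerate_in_set[OF assms, of 0] 0
    by (auto simp: consecutive_resets_def reset_position_def final_positions_def)
next
  case (Suc l)
  have "p j \<notin> pa_final A"
    if "enumerate (final_positions A p) l < j" "j < enumerate (final_positions A p) (Suc l)" for j
    using that not_less_Least[of j "\<lambda>s. s \<in> final_positions A p \<and> enumerate (final_positions A p) l < s"]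
    unfolding enumerate_Suc''[OF assms] by (auto simp: final_positions_def)
  then show ?thesis
    using enumerate_in_set[OF assms, of l] enumerate_in_set[OF assms, of "Suc l"]
      enumerate_step[OF assms, of l] Suc
    by (auto simp: consecutive_resets_def reset_position_def final_positions_def)
qed

text \<open>The right end \<open>k'\<close> is some enumerated final position and thereby the right
  end of an enumerated pair. The left ends agree, since the later of two distinct left ends would be
  a final position strictly inside the other interval.\<close>

lemma consecutive_resetsE:
  assumes inf: "infinite (final_positions A p)" and c: "consecutive_resets A p k k'"
  obtains i where "k = reset_position A p i" "k' = reset_position A p (Suc i)"
proof -
  let ?e = "enumerate (final_positions A p)"
  have "k' \<in> final_positions A p"
    using c by (auto simp: consecutive_resets_def final_positions_def)
  then obtain i where i: "?e i = k'"
    using enumerate_Ex inf by blast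
  have consec: "consecutive_resets A p (reset_position A p i) k'"
    using consecutive_resets_reset_position[OF inf, of i] i by (simp add: reset_position_def)
  have "k = reset_position A p i"
  proof (rule ccontr)
    assume ne: "k \<noteq> reset_position A p i"
    show False
    proof (cases "k < reset_position A p i")
      case True
      then have "p (reset_position A p i) \<in> pa_final A"
        using consec by (auto simp: consecutive_resets_def)
      then show False
        using True c consec by (auto simp: consecutive_resets_def)
    next
      case False
      then have "reset_position A p i < k" using ne by simp
      then show False
        using c consec by (auto simp: consecutive_resets_def)
    qed
  qed
  then show ?thesis
    using that[of i] i by (simp add: reset_position_def)
qed

lemma strong_reset_accepting_iff:
  "strong_reset_accepting A p v \<longleftrightarrow>
     infinite (final_positions A p) \<and>
     (\<forall>k k'. consecutive_resets A p k k' \<longrightarrow> segment_sum v k k' \<in> pa_constraint A)"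
  (is "_ \<longleftrightarrow> ?I \<and> ?C")
proof (cases ?I)
  case True
  have "(\<forall>i\<ge>1. segment_sum v (reset_position A p (i - 1)) (reset_position A p i) \<in> pa_constraint A) \<longleftrightarrow>
        (\<forall>i. segment_sum v (reset_position A p i) (reset_position A p (Suc i)) \<in> pa_constraint A)"
    by (auto simp: Suc_le_eq gr0_conv_Suc)
  also have "\<dots> \<longleftrightarrow> ?C"
    using consecutive_resets_reset_position[OF True] consecutive_resetsE[OF True] by metis
  finally show ?thesis
    using True by (simp add: strong_reset_accepting_def)
qed (simp add: strong_reset_accepting_def)

section \<open>Runs with a common prefix, and cutting a run at a reset\<close>

lemma pa_run_states:
  assumes "parikh_automaton A" "pa_run A \<alpha> p v"
  shows "p i \<in> pa_states A" "\<alpha> i \<in> pa_alphabet A"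
  using assms by (auto simp: parikh_automaton_def pa_run_def)

lemma pa_run_unique:
  assumes A: "parikh_automaton A" "pa_deterministic A"
    and run: "pa_run A \<alpha> p v" "pa_run A \<beta> p' v'"
    and eq: "\<And>i. i < k \<Longrightarrow> \<alpha> i = \<beta> i"
  shows "i \<le> k \<Longrightarrow> p i = p' i"
proof (induction i)
  case 0
  then show ?case using run by (simp add: pa_run_def)
next
  case (Suc i)
  have "(p i, \<alpha> i, v i, p (Suc i)) \<in> pa_trans A" "(p i, \<alpha> i, v' i, p' (Suc i)) \<in> pa_trans A"
    using run Suc eq[of i] unfolding pa_run_def by (simp_all add: Suc_le_eq) (metis less_imp_le)
  moreover have "\<exists>!t. t \<in> pa_trans A \<and> (\<exists>v q. t = (p i, \<alpha> i, v, q))"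
    using A(2) pa_run_states[OF A(1) run(1)] by (simp add: pa_deterministic_def)
  ultimately show ?case by blast
qed

lemma infinite_final_positions_suffix:
  "infinite (final_positions A (suffix k p)) \<longleftrightarrow> infinite (final_positions A p)"
proof -
  have "infinite (final_positions A p) \<longleftrightarrow> (\<forall>m. \<exists>n>m. p n \<in> pa_final A)" for p :: "'a word"
    unfolding infinite_nat_iff_unbounded final_positions_def by fastforce
  moreover have "(\<forall>m. \<exists>n>m. p (k + n) \<in> pa_final A) \<longleftrightarrow> (\<forall>m. \<exists>n>m. p n \<in> pa_final A)"
  proof (intro iffI allI)
    fix m
    assume "\<forall>m. \<exists>n>m. p n \<in> pa_final A"
    then obtain n where "n > k + m" "p n \<in> pa_final A" by blast
    then show "\<exists>n>m. p (k + n) \<in> pa_final A"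
      by (intro exI[of _ "n - k"]) auto
  next
    fix m
    assume "\<forall>m. \<exists>n>m. p (k + n) \<in> pa_final A"
    then obtain n where "n > m" "p (k + n) \<in> pa_final A" by blast
    then show "\<exists>n>m. p n \<in> pa_final A"
      by (intro exI[of _ "k + n"]) auto
  qed
  ultimately show ?thesis by (simp add: suffix_def)
qed

lemma segment_sum_shift: "segment_sum v (k + m) (k + n) = segment_sum (suffix k v) m n"
  using sum.shift_bounds_nat_ivl[of "\<lambda>i. v i j" m k n for j]
  by (simp add: segment_sum_def add.commute)

lemma segment_sum_cong:
  "(\<And>i. m \<le> i \<Longrightarrow> i < n \<Longrightarrow> v i = v' i) \<Longrightarrow> segment_sum v m n = segment_sum v' m n"
  by (simp add: segment_sum_def)

text \<open>A final position \<open>k\<close> separates the segments of a run into those up to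
  \<open>k\<close> and those from \<open>k\<close> on, with no sum carried across. The former are
  satisfied by the given run on \<alpha>, and the latter are exactly the segments of a run started
  in \<open>p k\<close>.\<close>

lemma residual_at_reset:
  fixes A :: "('q, 'a) pa"
  assumes A: "parikh_automaton A" "pa_deterministic A"
    and run: "pa_run A \<alpha> p v" and acc: "strong_reset_accepting A p v"
    and final: "p k \<in> pa_final A"
  shows "{x. prefix k \<alpha> \<frown> x \<in> strong_reset_language A} =
         strong_reset_language (A\<lparr>pa_init := p k\<rparr>)"
    (is "?L = strong_reset_language ?B")
proof (intro set_eqI iffI)
  fix x
  assume "x \<in> ?L"
  then obtain p' v' where run': "pa_run A (prefix k \<alpha> \<frown> x) p' v'"
    and acc': "strong_reset_accepting A p' v'"
    and dom: "prefix k \<alpha> \<frown> x \<in> omega_words (pa_alphabet A)"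
    by (auto simp: strong_reset_language_def)
  \<comment> \<open>Determinism enters here: the spliced word agrees with \<alpha> on its first
    \<open>k\<close> letters, so its run must also reach \<open>p k\<close>.\<close>
  have pk: "p' k = p k"
    using pa_run_unique[OF A run' run, of k k] by simp
  have "pa_run ?B x (suffix k p') (suffix k v')"
    unfolding pa_run_def
  proof (intro conjI allI)
    fix i
    show "(suffix k p' i, x i, suffix k v' i, suffix k p' (Suc i)) \<in> pa_trans ?B"
      using run'[unfolded pa_run_def, THEN conjunct2, rule_format, of "k + i"] by simp
  qed (use pk in simp)
  moreover have "strong_reset_accepting ?B (suffix k p') (suffix k v')"
    unfolding strong_reset_accepting_iff
  proof (intro conjI allI impI)
    show "infinite (final_positions ?B (suffix k p'))"
      using infinite_final_positions_suffix[of A k p'] acc'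
      by (simp add: final_positions_def strong_reset_accepting_def)
    fix i j
    assume c: "consecutive_resets ?B (suffix k p') i j"
    \<comment> \<open>A left end \<open>i = 0\<close> of the shifted run becomes position
      \<open>k\<close>, which is a legitimate left end in \<open>A\<close> because
      \<open>p k\<close> is final.\<close>
    have "consecutive_resets A p' (k + i) (k + j)"
      unfolding consecutive_resets_def
    proof (intro conjI allI impI)
      fix l assume l: "k + i < l \<and> l < k + j"
      then have "i < l - k \<and> l - k < j" "k + (l - k) = l" by auto
      moreover have "suffix k p' (l - k) \<notin> pa_final A"
        using c \<open>i < l - k \<and> l - k < j\<close> by (simp add: consecutive_resets_def)
      ultimately show "p' l \<notin> pa_final A" by simp
    qed (use c pk final in \<open>auto simp: consecutive_resets_def\<close>)
    then show "segment_sum (suffix k v') i j \<in> pa_constraint ?B"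
      using acc' by (simp add: strong_reset_accepting_iff flip: segment_sum_shift)
  qed
  ultimately show "x \<in> strong_reset_language ?B"
    using dom by (auto simp: strong_reset_language_def omega_words_def)
next
  fix x
  assume "x \<in> strong_reset_language ?B"
  then obtain p' v' where run': "pa_run ?B x p' v'" and acc': "strong_reset_accepting ?B p' v'"
    and dom: "x \<in> omega_words (pa_alphabet A)"
    by (auto simp: strong_reset_language_def)
  \<comment> \<open>The run on the spliced word: the given run up to position \<open>k\<close>,
    continued by the run started in \<open>p k\<close>. The two state sequences agree at the
    joint.\<close>
  define q where "q = prefix k p \<frown> p'"
  define w where "w = prefix k v \<frown> v'"
  have p'0: "p' 0 = p k" using run' by (simp add: pa_run_def)
  have q_le: "q i = p i" if "i \<le> k" for i
    using that p'0 by (cases "i = k") (auto simp: q_def)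
  have q_suf: "suffix k q = p'" and w_suf: "suffix k w = v'"
    by (auto simp: q_def w_def)
  have q_ge: "q (k + i) = p' i" for i
    using q_suf suffix_nth by metis
  have w_less: "w i = v i" if "i < k" for i
    using that by (simp add: w_def)
  have "pa_run A (prefix k \<alpha> \<frown> x) q w"
    unfolding pa_run_def
  proof (intro conjI allI)
    show "q 0 = pa_init A" using q_le[of 0] run by (simp add: pa_run_def)
    fix i
    show "(q i, (prefix k \<alpha> \<frown> x) i, w i, q (Suc i)) \<in> pa_trans A"
    proof (cases "i < k")
      case True
      then show ?thesis
        using run q_le[of i] q_le[of "Suc i"] w_less[of i] by (simp add: pa_run_def)
    next
      case False
      then obtain j where "i = k + j" using le_Suc_ex not_less by blast
      then show ?thesis
        using run' q_ge[of j] q_ge[of "Suc j"] by (simp add: pa_run_def w_def)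
    qed
  qed
  moreover have "strong_reset_accepting A q w"
    unfolding strong_reset_accepting_iff
  proof (intro conjI allI impI)
    show "infinite (final_positions A q)"
      using infinite_final_positions_suffix[of A k q] acc' q_suf
      by (simp add: final_positions_def strong_reset_accepting_def)
    fix i j
    assume c: "consecutive_resets A q i j"
    \<comment> \<open>No pair of consecutive resets can straddle the final position
      \<open>k\<close>, so each lies entirely in one of the two halves.\<close>
    have "q k \<in> pa_final A" using q_le[of k] final by simp
    then have "j \<le> k \<or> k \<le> i"
      using c unfolding consecutive_resets_def by (meson not_le)
    then show "segment_sum w i j \<in> pa_constraint A"
    proof
      assume j: "j \<le> k"
      then have "consecutive_resets A p i j"
        using c q_le by (auto simp: consecutive_resets_def)
      moreover have "segment_sum w i j = segment_sum v i j"
        using j w_less by (intro segment_sum_cong) auto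
      ultimately show ?thesis using acc by (simp add: strong_reset_accepting_iff)
    next
      assume "k \<le> i"
      then obtain i' j' where ij: "i = k + i'" "j = k + j'"
        using c unfolding consecutive_resets_def by (metis le_Suc_ex less_imp_le_nat order_trans)
      have "consecutive_resets ?B p' i' j'"
        unfolding consecutive_resets_def
      proof (intro conjI allI impI)
        fix l assume "i' < l \<and> l < j'"
        then have "q (k + l) \<notin> pa_final A"
          using c ij by (simp add: consecutive_resets_def)
        then show "p' l \<notin> pa_final ?B"
          using q_ge[of l] by simp
      qed (use c ij q_ge[of i'] q_ge[of j'] in \<open>auto simp: consecutive_resets_def\<close>)
      then show ?thesis
        using acc' ij w_suf by (simp add: strong_reset_accepting_iff segment_sum_shift)
    qed
  qed
  moreover have "prefix k \<alpha> \<frown> x \<in> omega_words (pa_alphabet A)"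
    using dom pa_run_states(2)[OF A(1) run] by (auto simp: omega_words_def)
  ultimately show "x \<in> ?L"
    by (auto simp: strong_reset_language_def)
qed

text \<open>The residual at a reset depends only on the state reached, so one language per state
  suffices for \<open>R\<close>. Resets beyond any bound \<open>m\<close> exist because an accepting
  run has infinitely many.\<close>

lemma finitely_many_residuals_at_resets:
  assumes "L \<in> det_strong_reset_languages \<Sigma>"
  obtains R where "finite R"
    and "\<And>\<alpha> m. \<alpha> \<in> L \<Longrightarrow> \<exists>k>m. {x. prefix k \<alpha> \<frown> x \<in> L} \<in> R"
proof -
  obtain A :: "(nat, 'a) pa" where A: "parikh_automaton A" "pa_deterministic A"
    and L: "L = strong_reset_language A"
    using assms by (auto simp: det_strong_reset_languages_def)
  show ?thesis
  proof (rule that[of "(\<lambda>q. strong_reset_language (A\<lparr>pa_init := q\<rparr>)) ` pa_states A"])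
    show "finite ((\<lambda>q. strong_reset_language (A\<lparr>pa_init := q\<rparr>)) ` pa_states A)"
      using A(1) by (simp add: parikh_automaton_def)
    fix \<alpha> :: "'a word" and m :: nat
    assume "\<alpha> \<in> L"
    then obtain p v where run: "pa_run A \<alpha> p v" and acc: "strong_reset_accepting A p v"
      by (auto simp: L strong_reset_language_def)
    obtain k where k: "k > m" "p k \<in> pa_final A"
      using acc unfolding strong_reset_accepting_def infinite_nat_iff_unbounded
      by (auto simp: final_positions_def)
    show "\<exists>k>m. {x. prefix k \<alpha> \<frown> x \<in> L} \<in>
        (\<lambda>q. strong_reset_language (A\<lparr>pa_init := q\<rparr>)) ` pa_states A"
      using residual_at_reset[OF A run acc k(2)] pa_run_states(1)[OF A(1) run] k(1)
      unfolding L by blast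
  qed
qed

section \<open>Automata over a two-letter alphabet\<close>

definition diagonal :: "natvec set" where
  "diagonal = {v \<in> natvecs 2. v 0 = v 1}"

text \<open>A single linear set is enough: base 0 and the one period \<open>(1, 1)\<close>, called
  \<open>u\<close> in the proof.\<close>

lemma semilinear_diagonal: "semilinear 2 diagonal"
proof -
  define u :: natvec where "u = (\<lambda>i. if i < 2 then 1 else 0)"
  have "linear_set (\<lambda>_. 0) {u} = {(\<lambda>i. u i * n) | n. True}"
    unfolding linear_set_def by (auto intro: exI[of _ "\<lambda>_. n" for n])
  also have "\<dots> = diagonal"
  proof (intro set_eqI iffI)
    fix v :: natvec
    assume "v \<in> diagonal"
    then have "v = (\<lambda>i. u i * v 0)"
      by (auto simp: diagonal_def natvecs_def u_def fun_eq_iff less_2_cases_iff)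
    then show "v \<in> {(\<lambda>i. u i * n) | n. True}" by blast
  qed (auto simp: diagonal_def natvecs_def u_def)
  finally show ?thesis
    unfolding semilinear_def
    by (intro exI[of _ "{(\<lambda>_. 0, {u})}"]) (auto simp: natvecs_def u_def)
qed

text \<open>The vector of a transition depends on its source state alone, as outputs do in a Moore
  machine. The vector sequence is then a function of the state sequence. Four states and the
  diagonal constraint serve every automaton built here.\<close>

definition moore_pa ::
    "(nat \<Rightarrow> nat \<Rightarrow> nat) \<Rightarrow> (nat \<Rightarrow> natvec) \<Rightarrow> nat set \<Rightarrow> (nat, nat) pa" where
  "moore_pa \<delta> w F = \<lparr>pa_dim = 2, pa_states = {..<4}, pa_alphabet = {0, 1}, pa_init = 0,
     pa_trans = {(q, a, w q, \<delta> q a) | q a. q < 4 \<and> a \<in> {0, 1}},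
     pa_final = F, pa_constraint = diagonal\<rparr>"

primrec state_seq :: "(nat \<Rightarrow> nat \<Rightarrow> nat) \<Rightarrow> nat word \<Rightarrow> nat word" where
  "state_seq \<delta> \<alpha> 0 = 0"
| "state_seq \<delta> \<alpha> (Suc i) = \<delta> (state_seq \<delta> \<alpha> i) (\<alpha> i)"

context
  fixes \<delta> :: "nat \<Rightarrow> nat \<Rightarrow> nat" and w :: "nat \<Rightarrow> natvec" and F :: "nat set"
  assumes \<delta>_less: "\<And>q a. \<delta> q a < 4"
    and w_natvecs: "\<And>q. w q \<in> natvecs 2"
    and F_subset: "F \<subseteq> {..<4}"
begin

lemma pa_run_moore_iff:
  "pa_run (moore_pa \<delta> w F) \<alpha> p v \<longleftrightarrow>
     \<alpha> \<in> omega_words {0, 1} \<and> p = state_seq \<delta> \<alpha> \<and> v = (\<lambda>i. w (p i))"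
proof
  assume run: "pa_run (moore_pa \<delta> w F) \<alpha> p v"
  have "p i = state_seq \<delta> \<alpha> i" for i
    using run by (induction i) (auto simp: pa_run_def moore_pa_def)
  moreover have "\<alpha> i \<in> {0, 1}" "v i = w (p i)" for i
    using run by (auto simp: pa_run_def moore_pa_def)
  ultimately show "\<alpha> \<in> omega_words {0, 1} \<and> p = state_seq \<delta> \<alpha> \<and> v = (\<lambda>i. w (p i))"
    by (simp add: omega_words_def image_subset_iff fun_eq_iff)
next
  have "state_seq \<delta> \<alpha> i < 4" for i
    using \<delta>_less by (cases i) auto
  moreover assume "\<alpha> \<in> omega_words {0, 1} \<and> p = state_seq \<delta> \<alpha> \<and> v = (\<lambda>i. w (p i))"
  ultimately show "pa_run (moore_pa \<delta> w F) \<alpha> p v"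
    by (auto simp: pa_run_def moore_pa_def omega_words_def)
qed

lemma strong_reset_language_moore:
  "strong_reset_language (moore_pa \<delta> w F) =
     {\<alpha> \<in> omega_words {0, 1}. strong_reset_accepting (moore_pa \<delta> w F)
        (state_seq \<delta> \<alpha>) (\<lambda>i. w (state_seq \<delta> \<alpha> i))}"
  by (auto simp: strong_reset_language_def pa_run_moore_iff) (simp_all add: moore_pa_def)

lemma moore_language_in_class:
  "strong_reset_language (moore_pa \<delta> w F) \<in> det_strong_reset_languages {0, 1}"
proof -
  have "pa_trans (moore_pa \<delta> w F) = (\<lambda>(q, a). (q, a, w q, \<delta> q a)) ` ({..<4} \<times> {0, 1})"
    by (auto simp: moore_pa_def)
  then have "parikh_automaton (moore_pa \<delta> w F)"
    unfolding parikh_automaton_def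
    using semilinear_diagonal \<delta>_less w_natvecs F_subset by (auto simp: moore_pa_def)
  moreover have "pa_deterministic (moore_pa \<delta> w F)"
    by (auto simp: pa_deterministic_def moore_pa_def)
  ultimately show ?thesis
    unfolding det_strong_reset_languages_def
    by (auto intro!: exI[of _ "moore_pa \<delta> w F"] simp: moore_pa_def)
qed

end

lemma singleton_zero_word_in_class:
  "{\<lambda>_. 0} \<in> det_strong_reset_languages {0, 1 :: nat}"
proof -
  \<comment> \<open>State 0 is final and survives only the letter 0; everything else falls into the
    sink 1. All vectors are zero, so the constraint always holds.\<close>
  define \<delta> :: "nat \<Rightarrow> nat \<Rightarrow> nat" where "\<delta> = (\<lambda>q a. if q = 0 \<and> a = 0 then 0 else 1)"
  define A where "A = moore_pa \<delta> (\<lambda>_ _. 0) {0}"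
  have \<delta>: "\<delta> q a < 4" for q a by (simp add: \<delta>_def)
  have zero: "\<alpha> = (\<lambda>_. 0)" if inf: "infinite (final_positions A (state_seq \<delta> \<alpha>))" for \<alpha>
  proof
    fix i
    obtain k where k: "k > i" "state_seq \<delta> \<alpha> k = 0"
      using inf unfolding infinite_nat_iff_unbounded
      by (auto simp: final_positions_def A_def moore_pa_def)
    \<comment> \<open>A nonzero letter at position \<open>i\<close> puts the run into the sink from
      position \<open>Suc i\<close> on, contradicting the later visit to state 0.\<close>
    have "state_seq \<delta> \<alpha> k \<noteq> 0" if "\<alpha> i \<noteq> 0"
      using Suc_leI[OF k(1)] that by (induction rule: dec_induct) (auto simp: \<delta>_def)
    then show "\<alpha> i = 0" using k(2) by blast
  qed
  have "state_seq \<delta> (\<lambda>_. 0) i = 0" for i by (induction i) (auto simp: \<delta>_def)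
  moreover have "infinite {k :: nat. 1 \<le> k}"
    by (metis atLeast_def infinite_Ici)
  ultimately have "strong_reset_accepting A (state_seq \<delta> (\<lambda>_. 0)) (\<lambda>_ _. 0)"
    by (simp add: strong_reset_accepting_def A_def moore_pa_def final_positions_def
        segment_sum_def diagonal_def natvecs_def)
  then have "strong_reset_language A = {\<lambda>_. 0}"
    using zero unfolding A_def
    by (subst strong_reset_language_moore)
       (auto simp: \<delta> natvecs_def omega_words_def strong_reset_accepting_def)
  moreover have "strong_reset_language A \<in> det_strong_reset_languages {0, 1}"
    unfolding A_def by (rule moore_language_in_class) (auto simp: \<delta> natvecs_def)
  ultimately show ?thesis by simp
qed

section \<open>Words of balanced blocks\<close>

definition block_start :: "'a \<Rightarrow> 'a word \<Rightarrow> nat \<Rightarrow> bool" where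
  "block_start x \<alpha> k \<longleftrightarrow> \<alpha> k = x \<and> (k = 0 \<or> \<alpha> (k - 1) \<noteq> x)"

text \<open>The final clause makes the second half end exactly at \<open>k + 2 * n\<close>. This
  rules out an infinite tail of other letters and forces another block of \<open>x\<close> to begin
  there.\<close>

definition balanced_block :: "'a \<Rightarrow> 'a word \<Rightarrow> nat \<Rightarrow> nat \<Rightarrow> bool" where
  "balanced_block x \<alpha> k n \<longleftrightarrow> n \<ge> 1 \<and> (\<forall>i<n. \<alpha> (k + i) = x) \<and>
     (\<forall>i<n. \<alpha> (k + n + i) \<noteq> x) \<and> \<alpha> (k + 2 * n) = x"

text \<open>One block start already yields infinitely many, since each balanced block leads to the
  next. The letters before the first \<open>x\<close> are unconstrained.\<close>

definition balanced_words :: "'a \<Rightarrow> 'a word set" where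
  "balanced_words x = {\<alpha>. (\<exists>k. block_start x \<alpha> k) \<and>
     (\<forall>k. block_start x \<alpha> k \<longrightarrow> (\<exists>n. balanced_block x \<alpha> k n))}"

lemma balanced_block_next:
  assumes "balanced_block x \<alpha> k n"
  shows "block_start x \<alpha> (k + 2 * n)"
proof -
  have "k + 2 * n - 1 = k + n + (n - 1)" "n - 1 < n"
    using assms by (auto simp: balanced_block_def)
  then show ?thesis
    using assms unfolding balanced_block_def block_start_def by metis
qed

lemma balanced_block_no_start:
  assumes "balanced_block x \<alpha> k n" "k < j" "j < k + 2 * n"
  shows "\<not> block_start x \<alpha> j"
proof (cases "j < k + n")
  case True
  then have "j - 1 = k + (j - 1 - k)" "j - 1 - k < n"
    using assms(2) by auto
  then have "\<alpha> (j - 1) = x"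
    using assms(1) unfolding balanced_block_def by metis
  then show ?thesis using assms(2) by (simp add: block_start_def)
next
  case False
  then obtain i where "j = k + n + i" "i < n"
    using assms(3) le_Suc_ex[of "k + n" j] by auto
  then show ?thesis
    using assms(1) by (simp add: balanced_block_def block_start_def)
qed

text \<open>
  State 0: no \<open>x\<close> read so far; 1: first \<open>x\<close> of a block; 2: later \<open>x\<close> of a block; 3: other letter
  after an \<open>x\<close>. A letter is counted when its target state is left, so that the sum from one visit
  of state 1 to the next ranges over exactly one block.
\<close>

definition block_step :: "nat \<Rightarrow> nat \<Rightarrow> nat \<Rightarrow> nat" where
  "block_step x q a =
     (if a = x then if q = 1 \<or> q = 2 then 2 else 1 else if q = 0 then 0 else 3)"

definition block_weight :: "nat \<Rightarrow> natvec" where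
  "block_weight q =
     (if q = 0 then (\<lambda>_. 0) else if q = 3 then (\<lambda>_. 0)(1 := 1) else (\<lambda>_. 0)(0 := 1))"

definition block_pa :: "nat \<Rightarrow> (nat, nat) pa" where
  "block_pa x = moore_pa (block_step x) block_weight {1}"

abbreviation block_seq :: "nat \<Rightarrow> nat word \<Rightarrow> nat word" where
  "block_seq x \<equiv> state_seq (block_step x)"

section \<open>The block automaton measures block lengths\<close>

lemma block_seq_x_iff: "block_seq x \<alpha> (Suc i) \<in> {1, 2} \<longleftrightarrow> \<alpha> i = x"
  by (simp add: block_step_def)

text \<open>State 1 is entered on reading \<open>x\<close> from a state other than 1 and 2, that is,
  when the preceding letter is missing or differs from \<open>x\<close>. The state at
  \<open>Suc i\<close> reflects letter \<open>i\<close>, hence the shift by one.\<close>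

lemma block_seq_final_iff: "block_seq x \<alpha> k = 1 \<longleftrightarrow> (\<exists>i. k = Suc i \<and> block_start x \<alpha> i)"
proof (cases k)
  case (Suc i)
  have "block_seq x \<alpha> i \<in> {1, 2} \<longleftrightarrow> i \<noteq> 0 \<and> \<alpha> (i - 1) = x"
    using block_seq_x_iff[of x \<alpha> "i - 1"] by (cases i) auto
  then show ?thesis
    using Suc by (auto simp: block_step_def block_start_def)
qed simp

text \<open>State 0 can only be left for state 1. This makes the segment before the first reset sum
  to zero.\<close>

lemma block_seq_zero_before_start:
  assumes "\<And>j. j < k \<Longrightarrow> block_seq x \<alpha> j \<noteq> 1" "j < k"
  shows "block_seq x \<alpha> j = 0"
  using assms(2)
proof (induction j)
  case (Suc j)
  then have "block_seq x \<alpha> (Suc j) = (if \<alpha> j = x then 1 else 0)"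
    by (simp add: block_step_def[of x "block_seq x \<alpha> j"] block_step_def[of x 0])
  then show ?case
    using assms(1)[OF Suc.prems] by metis
qed simp

text \<open>State 0 is never re-entered once an \<open>x\<close> has been read, so from then on the
  weight of a state records the last letter: coordinate 0 for \<open>x\<close>, coordinate 1 for any
  other letter.\<close>

lemma block_weight_after_start:
  assumes "block_start x \<alpha> k" "k \<le> i"
  shows "block_weight (block_seq x \<alpha> (Suc i)) = (\<lambda>_. 0)(if \<alpha> i = x then 0 else 1 := 1)"
proof -
  have "block_seq x \<alpha> (Suc i) \<noteq> 0"
    using assms(2)
  proof (induction i rule: dec_induct)
    case base
    have "block_seq x \<alpha> (Suc k) = 1"
      using assms(1) block_seq_final_iff by blast
    then show ?case by simp
  qed (auto simp: block_step_def)
  then show ?thesis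
    using block_seq_x_iff[of x \<alpha> i]
    by (auto simp: block_weight_def block_step_def split: if_splits)
qed

lemma segment_sum_block:
  assumes "block_start x \<alpha> k"
    and "\<And>i. i < n \<Longrightarrow> \<alpha> (k + i) = x" "\<And>i. i < m \<Longrightarrow> \<alpha> (k + n + i) \<noteq> x"
  shows "segment_sum (\<lambda>i. block_weight (block_seq x \<alpha> i)) (Suc k) (Suc (k + n + m)) =
    ((\<lambda>_. 0)(0 := n, 1 := m))"
proof
  fix j
  let ?f = "\<lambda>i. block_weight (block_seq x \<alpha> (Suc i)) j"
  have "segment_sum (\<lambda>i. block_weight (block_seq x \<alpha> i)) (Suc k) (Suc (k + n + m)) j =
      sum ?f {k..<k + n + m}"
    \<comment> \<open>Letter \<open>i\<close> is counted by the transition leaving the state at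
      \<open>Suc i\<close>; shifting the index aligns the sum with the letters.\<close>
    unfolding segment_sum_def by (rule sum.shift_bounds_Suc_ivl)
  also have "\<dots> = sum ?f {k..<k + n} + sum ?f {k + n..<k + n + m}"
    by (rule sum.atLeastLessThan_concat[symmetric]) auto
  also have "sum ?f {k..<k + n} = (\<Sum>i\<in>{k..<k + n}. if j = 0 then 1 else 0)"
  proof (rule sum.cong)
    fix i assume "i \<in> {k..<k + n}"
    then have "k \<le> i" "i - k < n" by auto
    then show "?f i = (if j = 0 then 1 else 0)"
      using block_weight_after_start[OF assms(1), of i] assms(2)[of "i - k"] by auto
  qed simp
  also have "sum ?f {k + n..<k + n + m} = (\<Sum>i\<in>{k + n..<k + n + m}. if j = 1 then 1 else 0)"
  proof (rule sum.cong)
    fix i assume "i \<in> {k + n..<k + n + m}"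
    then have "k + n \<le> i" "i - (k + n) < m" by auto
    then show "?f i = (if j = 1 then 1 else 0)"
      using block_weight_after_start[OF assms(1), of i] assms(3)[of "i - (k + n)"] by auto
  qed simp
  finally show "segment_sum (\<lambda>i. block_weight (block_seq x \<alpha> i)) (Suc k) (Suc (k + n + m)) j =
      ((\<lambda>_. 0)(0 := n, 1 := m)) j" by simp
qed

lemma two_run_sum_diagonal_iff: "((\<lambda>_. 0)(0 := n, 1 := m)) \<in> diagonal \<longleftrightarrow> n = m"
  by (auto simp: diagonal_def natvecs_def)

text \<open>After the first reset, consecutive resets are consecutive block starts shifted by one,
  and the sum between them is the pair of lengths of the block of \<open>x\<close> and of the block
  after it. The diagonal constraint thus says that these lengths agree.\<close>

lemma block_accepting_iff:
  "strong_reset_accepting (block_pa x) (block_seq x \<alpha>) (\<lambda>i. block_weight (block_seq x \<alpha> i)) \<longleftrightarrow>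
     \<alpha> \<in> balanced_words x" (is "?acc \<longleftrightarrow> _")
proof
  let ?v = "\<lambda>i. block_weight (block_seq x \<alpha> i)"
  assume acc: ?acc
  have later: "\<exists>k'>k. block_start x \<alpha> k'" for k
  proof -
    obtain l where "l > Suc k" "l \<in> final_positions (block_pa x) (block_seq x \<alpha>)"
      using acc unfolding strong_reset_accepting_def infinite_nat_iff_unbounded by blast
    then show ?thesis
      using block_seq_final_iff[of x \<alpha> l]
      by (auto simp: final_positions_def block_pa_def moore_pa_def)
  qed
  have "\<exists>n. balanced_block x \<alpha> k n" if k: "block_start x \<alpha> k" for k
  proof -
    \<comment> \<open>The next block start after \<open>k\<close>; it exists because resets recur
      forever.\<close>
    define k' where "k' = (LEAST k'. k < k' \<and> block_start x \<alpha> k')"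
    have k': "k < k'" "block_start x \<alpha> k'"
      using LeastI_ex[OF later[of k]] unfolding k'_def by auto
    have no_start: "\<not> block_start x \<alpha> j" if "k < j" "j < k'" for j
      using not_less_Least[of j "\<lambda>k'. k < k' \<and> block_start x \<alpha> k'"] that
      unfolding k'_def by blast
    have y: "\<alpha> (k' - 1) \<noteq> x" using k' by (auto simp: block_start_def)
    \<comment> \<open>The length of the block of \<open>x\<close> at \<open>k\<close>. It is well
      defined and ends before \<open>k'\<close>, as the letter just before \<open>k'\<close> differs
      from \<open>x\<close>.\<close>
    define n where "n = (LEAST n. \<alpha> (k + n) \<noteq> x)"
    have n: "\<alpha> (k + n) \<noteq> x"
      unfolding n_def by (rule LeastI[of _ "k' - 1 - k"]) (use y k' in simp)
    have "n \<le> k' - 1 - k"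
      unfolding n_def by (rule Least_le) (use y k' in simp)
    then have "k + n < k'" using k'(1) by linarith
    then obtain m where m: "k' = k + n + m" "m > 0"
      using less_imp_add_positive by blast
    have xs: "\<alpha> (k + i) = x" if "i < n" for i
      using not_less_Least that unfolding n_def by blast
    \<comment> \<open>Past the first other letter, an \<open>x\<close> before \<open>k'\<close>
      would be a block start strictly between \<open>k\<close> and \<open>k'\<close>.\<close>
    have ys: "\<alpha> (k + n + i) \<noteq> x" if "i < m" for i
      using that
    proof (induction i)
      case (Suc i)
      then show ?case
        using no_start[of "k + n + Suc i"] m by (auto simp: block_start_def)
    qed (use n in simp)
    have "consecutive_resets (block_pa x) (block_seq x \<alpha>) (Suc k) (Suc k')"
      using k k' no_start block_seq_final_iff[of x \<alpha>]
      by (auto simp: consecutive_resets_def block_pa_def moore_pa_def simp del: state_seq.simps)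
    then have "segment_sum ?v (Suc k) (Suc (k + n + m)) \<in> diagonal"
      using acc m by (auto simp: strong_reset_accepting_iff block_pa_def moore_pa_def)
    then have "n = m"
      using segment_sum_block[OF k xs ys] two_run_sum_diagonal_iff by simp
    then have "balanced_block x \<alpha> k n"
      using m xs ys k'(2) by (auto simp: balanced_block_def block_start_def mult_2 add.assoc)
    then show ?thesis ..
  qed
  then show "\<alpha> \<in> balanced_words x"
    using later by (auto simp: balanced_words_def)
next
  let ?v = "\<lambda>i. block_weight (block_seq x \<alpha> i)"
  assume bal: "\<alpha> \<in> balanced_words x"
  show ?acc
    unfolding strong_reset_accepting_iff
  proof (intro conjI allI impI)
    have "\<exists>k>m. block_start x \<alpha> k" for m
    proof (induction m)
      case 0
      obtain k n where "block_start x \<alpha> k" "balanced_block x \<alpha> k n"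
        using bal by (auto simp: balanced_words_def)
      then show ?case
        using balanced_block_next[of x \<alpha> k n]
        by (auto intro!: exI[of _ "k + 2 * n"] simp: balanced_block_def)
    next
      case (Suc m)
      then obtain k n where "k > m" "block_start x \<alpha> k" "balanced_block x \<alpha> k n"
        using bal by (auto simp: balanced_words_def)
      then show ?case
        using balanced_block_next[of x \<alpha> k n]
        by (auto intro!: exI[of _ "k + 2 * n"] simp: balanced_block_def)
    qed
    then show "infinite (final_positions (block_pa x) (block_seq x \<alpha>))"
      unfolding infinite_nat_iff_unbounded final_positions_def block_pa_def moore_pa_def
      using block_seq_final_iff[of x \<alpha>]
      by (simp del: state_seq.simps) (metis less_Suc_eq Suc_leI zero_less_Suc)
    fix i j
    assume c: "consecutive_resets (block_pa x) (block_seq x \<alpha>) i j"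
    then obtain k' where k': "j = Suc k'" "block_start x \<alpha> k'"
      using block_seq_final_iff[of x \<alpha> j]
      by (auto simp: consecutive_resets_def block_pa_def moore_pa_def)
    show "segment_sum ?v i j \<in> pa_constraint (block_pa x)"
    proof (cases "i = 0")
      case True
      \<comment> \<open>The initial segment never visits state 1 before its end, so it sums to the
        zero vector, which lies on the diagonal.\<close>
      have "block_seq x \<alpha> l \<noteq> 1" if "l < j" for l
        using c that True
        by (cases "l = 0") (auto simp: consecutive_resets_def block_pa_def moore_pa_def)
      then have "block_seq x \<alpha> l = 0" if "l < j" for l
        using block_seq_zero_before_start that by blast
      then have "segment_sum ?v i j = (\<lambda>_. 0)"
        by (auto simp: segment_sum_def block_weight_def)
      then show ?thesis
        by (simp add: block_pa_def moore_pa_def diagonal_def natvecs_def)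
    next
      case False
      then obtain k where k: "i = Suc k" "block_start x \<alpha> k"
        using c block_seq_final_iff[of x \<alpha> i]
        by (auto simp: consecutive_resets_def block_pa_def moore_pa_def)
      then obtain n where n: "balanced_block x \<alpha> k n"
        using bal by (auto simp: balanced_words_def)
      have no_start: "\<not> block_start x \<alpha> l" if "k < l" "l < k'" for l
        using c k k' that block_seq_final_iff[of x \<alpha> "Suc l"]
        by (auto simp: consecutive_resets_def block_pa_def moore_pa_def simp del: state_seq.simps)
      have "k < k'" using c k k' by (simp add: consecutive_resets_def)
      \<comment> \<open>The next start \<open>k'\<close> cannot lie inside the balanced block, and
        it cannot lie beyond \<open>k + 2 * n\<close>, which is itself a block start; so
        \<open>k' = k + 2 * n\<close>.\<close>
      then have "\<not> k' < k + 2 * n"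
        using balanced_block_no_start[OF n, of k'] k' by blast
      moreover have "\<not> k + 2 * n < k'"
        using no_start[of "k + 2 * n"] balanced_block_next[OF n] n
        by (auto simp: balanced_block_def)
      ultimately have "k' = k + n + n" by simp
      then show ?thesis
        using segment_sum_block[OF k(2), of n n] n k k' two_run_sum_diagonal_iff[of n n]
        by (simp add: balanced_block_def block_pa_def moore_pa_def)
    qed
  qed
qed

lemma balanced_language_in_class:
  fixes x :: nat
  shows "omega_words {0, 1} \<inter> balanced_words x \<in> det_strong_reset_languages {0, 1}"
proof -
  have step: "block_step x q a < 4" and weight: "block_weight q \<in> natvecs 2" for q a
    by (auto simp: block_step_def block_weight_def natvecs_def)
  have final: "{1 :: nat} \<subseteq> {..<4}" by simp
  have "strong_reset_language (block_pa x) = omega_words {0, 1} \<inter> balanced_words x"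
    using block_accepting_iff[of x] strong_reset_language_moore[OF step weight final]
    by (auto simp: block_pa_def)
  then show ?thesis
    using moore_language_in_class[of "block_step x" block_weight "{1}", OF step weight final]
    by (simp add: block_pa_def)
qed

section \<open>Non-membership\<close>

definition two_run_word :: "nat \<Rightarrow> nat \<Rightarrow> nat word" where
  "two_run_word m n = (\<lambda>i. if i < m then 0 else if i < m + n then 1 else (i - (m + n)) mod 2)"

lemma two_run_word_omega: "two_run_word m n \<in> omega_words {0, 1}"
  by (auto simp: two_run_word_def omega_words_def)

text \<open>The blocks of 0 in the tail \<open>(01)^\<omega>\<close> are balanced with length 1, so
  only the first block, \<open>0^m\<close> followed by \<open>1^n\<close>, can fail.\<close>

lemma two_run_word_balanced_iff:
  assumes "m \<ge> 1" "n \<ge> 1"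
  shows "two_run_word m n \<in> balanced_words 0 \<longleftrightarrow> m = n"
proof
  assume bal: "two_run_word m n \<in> balanced_words 0"
  have "block_start 0 (two_run_word m n) 0"
    using assms by (simp add: block_start_def two_run_word_def)
  then obtain l where l: "balanced_block 0 (two_run_word m n) 0 l"
    using bal by (auto simp: balanced_words_def)
  have "l \<le> m"
  proof (rule ccontr)
    assume "\<not> l \<le> m"
    then have "two_run_word m n (0 + m) = 0" using l unfolding balanced_block_def by simp
    then show False using assms by (simp add: two_run_word_def)
  qed
  moreover have "m \<le> l"
  proof (rule ccontr)
    assume "\<not> m \<le> l"
    then show False using l assms unfolding balanced_block_def two_run_word_def
      by (auto dest!: spec[of _ 0])
  qed
  ultimately have "l = m" by simp
  then have ones: "\<forall>i<m. two_run_word m n (m + i) \<noteq> 0" and zero: "two_run_word m n (m + m) = 0"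
    using l by (auto simp: balanced_block_def mult_2)
  \<comment> \<open>If \<open>n < m\<close>, the 0 opening the tail falls among the positions
    required to be nonzero; if \<open>m < n\<close>, position \<open>m + m\<close> still carries a
    1.\<close>
  have "\<not> n < m"
    using ones by (auto simp: two_run_word_def dest!: spec[of _ n])
  moreover have "\<not> m < n"
    using zero by (auto simp: two_run_word_def)
  ultimately show "m = n" by simp
next
  assume mn: "m = n"
  have "\<exists>l. balanced_block 0 (two_run_word m n) k l" if k: "block_start 0 (two_run_word m n) k" for k
  proof (cases "k = 0")
    case True
    then have "balanced_block 0 (two_run_word m n) k m"
      using mn assms by (auto simp: balanced_block_def two_run_word_def)
    then show ?thesis ..
  next
    case False
    have "\<not> k < m" "\<not> k < m + n"
      using k False by (auto simp: block_start_def two_run_word_def split: if_splits)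
    then obtain t where t: "k = m + n + t" by (auto simp: not_less le_iff_add)
    then have "t mod 2 = 0" using k by (simp add: block_start_def two_run_word_def)
    then have "balanced_block 0 (two_run_word m n) k 1"
      using t by (auto simp: balanced_block_def two_run_word_def mod_Suc)
    then show ?thesis ..
  qed
  moreover have "block_start 0 (two_run_word m n) 0"
    using assms by (simp add: block_start_def two_run_word_def)
  ultimately show "two_run_word m n \<in> balanced_words 0"
    by (auto simp: balanced_words_def)
qed

lemma zero_word_not_balanced: "(\<lambda>_. 0) \<notin> balanced_words (0 :: nat)"
  by (auto simp: balanced_words_def balanced_block_def block_start_def intro!: exI[of _ "0 :: nat"])

text \<open>The flag \<open>b\<close> selects whether \<open>L\<close> accepts the words with
  \<open>m = n\<close> or those with \<open>m \<noteq> n\<close>, so that union and complement share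
  one pigeonhole argument.\<close>

lemma not_in_class_if_counts_zeros:
  assumes zero: "(\<lambda>_. 0) \<in> L"
    and mid: "\<And>m n. m \<ge> 1 \<Longrightarrow> n \<ge> 1 \<Longrightarrow> two_run_word m n \<in> L \<longleftrightarrow> (m = n \<longleftrightarrow> b)"
  shows "L \<notin> det_strong_reset_languages \<Sigma>"
proof
  assume "L \<in> det_strong_reset_languages \<Sigma>"
  then obtain R where R: "finite R"
    "\<And>m. \<exists>k>m. {x. prefix k (\<lambda>_. 0) \<frown> x \<in> L} \<in> R"
    using finitely_many_residuals_at_resets zero by metis
  define res where "res k = {x. prefix k (\<lambda>_. 0) \<frown> x \<in> L}" for k
  \<comment> \<open>The lengths of nonempty zero prefixes with residual in \<open>R\<close>. There
    are infinitely many lengths but finitely many residuals, so two lengths share one;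
    \<open>k \<ge> 1\<close> lets \<open>mid\<close> apply to them.\<close>
  define K where "K = {k. k \<ge> 1 \<and> res k \<in> R}"
  have "infinite K"
    unfolding infinite_nat_iff_unbounded
  proof
    fix m
    obtain k where "k > m" "res k \<in> R" using R(2) unfolding res_def by blast
    then show "\<exists>n>m. n \<in> K" by (intro exI[of _ k]) (simp add: K_def)
  qed
  moreover have "finite (res ` K)"
    using R(1) by (rule finite_subset[rotated]) (auto simp: K_def)
  ultimately have "\<not> inj_on res K"
    using finite_imageD by blast
  then obtain i j where ij: "i \<in> K" "j \<in> K" "res i = res j" "i \<noteq> j"
    by (auto simp: inj_on_def)
  \<comment> \<open>\<open>two_run_word 0 n\<close> is the common continuation
    \<open>1^n (01)^\<omega>\<close>, so equal residuals make membership independent of the choice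
    between the two zero prefixes.\<close>
  have split: "prefix m (\<lambda>_. 0) \<frown> two_run_word 0 n = two_run_word m n" for m n
    by (auto simp: fun_eq_iff conc_def two_run_word_def)
  have "two_run_word i i \<in> L \<longleftrightarrow> two_run_word j i \<in> L"
    using arg_cong[OF ij(3), of "\<lambda>S. two_run_word 0 i \<in> S"] by (simp add: res_def split)
  then show False
    using mid[of i i] mid[of j i] ij by (auto simp: K_def)
qed

section \<open>The words \<open>(0^n 1^n)^\<omega>\<close> for \<open>n \<ge> 1\<close>, and the
  intersection\<close>

definition square_wave :: "nat \<Rightarrow> nat word" where
  "square_wave n = (\<lambda>i. (i div n) mod 2)"

lemma square_wave_omega: "square_wave n \<in> omega_words {0, 1}"
  by (auto simp: square_wave_def omega_words_def)

lemma square_wave_add: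
  assumes "n \<ge> 1"
  shows "square_wave n (i + n) \<noteq> square_wave n i"
  using assms by (simp add: square_wave_def div_add_self2 mod_Suc)

lemma square_wave_mult:
  assumes "i < n"
  shows "square_wave n (n * j + i) = j mod 2"
  using assms by (simp add: square_wave_def)

lemma square_wave_balanced:
  assumes "n \<ge> 1" "x \<in> {0, 1}"
  shows "square_wave n \<in> balanced_words x"
proof -
  have "\<exists>l. balanced_block x (square_wave n) k l" if k: "block_start x (square_wave n) k" for k
  proof -
    define j where "j = k div n"
    have j: "j mod 2 = x" using k by (simp add: block_start_def square_wave_def j_def)
    \<comment> \<open>Otherwise \<open>k - 1\<close> lies in the same stretch of \<open>n\<close>
      equal letters, so \<open>k\<close> would not start a block.\<close>
    have "k mod n = 0"
    proof (rule ccontr)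
      assume ne: "k mod n \<noteq> 0"
      have "k - 1 = n * j + (k mod n - 1)"
        using ne mult_div_mod_eq[of n k] unfolding j_def by linarith
      moreover have "k mod n - 1 < n" using assms by (simp add: less_imp_diff_less)
      ultimately have "square_wave n (k - 1) = x"
        using square_wave_mult[of "k mod n - 1" n j] j by simp
      moreover have "k \<noteq> 0" using ne by (intro notI) simp
      ultimately show False using k by (simp add: block_start_def)
    qed
    then have k_eq: "k = n * j" unfolding j_def by auto
    have "balanced_block x (square_wave n) k n"
      unfolding balanced_block_def
    proof (intro conjI allI impI)
      fix i assume i: "i < n"
      show "square_wave n (k + i) = x"
        using square_wave_mult[OF i] j k_eq by simp
      show "square_wave n (k + n + i) \<noteq> x"
        using square_wave_mult[OF i, of "Suc j"] j k_eq by (simp add: algebra_simps mod_Suc)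
    next
      have "k + 2 * n = n * Suc (Suc j) + 0" using k_eq by simp
      moreover have "Suc (Suc j) mod 2 = x" using j by simp
      ultimately show "square_wave n (k + 2 * n) = x"
        using square_wave_mult[of 0 n "Suc (Suc j)"] assms(1) by presburger
    qed (use assms in auto)
    then show ?thesis ..
  qed
  \<comment> \<open>The first block of letter 0 starts at 0 and that of letter 1 at
    \<open>n\<close>, which is \<open>n * x\<close> in both cases.\<close>
  moreover have "block_start x (square_wave n) (n * x)"
    using assms square_wave_mult[of "n - 1" n 0] square_wave_mult[of 0 n x]
    by (auto simp: block_start_def)
  ultimately show ?thesis
    by (auto simp: balanced_words_def)
qed

text \<open>Balance for 0 passes the length of each block of 0 on to the following block of 1, and
  balance for 1 passes it on to the next block of 0. The first length \<open>n\<close> therefore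
  determines the whole word.\<close>

lemma balanced_eq_square_wave:
  assumes bal: "\<alpha> \<in> balanced_words 0" "\<alpha> \<in> balanced_words 1"
    and om: "\<alpha> \<in> omega_words {0, 1}"
    and n: "n \<ge> 1" and zeros: "\<And>i. i < n \<Longrightarrow> \<alpha> i = 0" and one: "\<alpha> n = 1"
  shows "\<alpha> = square_wave n"
proof -
  have two: "\<alpha> i = 0 \<or> \<alpha> i = 1" for i using om by (auto simp: omega_words_def)
  \<comment> \<open>The invariant for the \<open>j\<close>-th block: it starts at
    \<open>n * j\<close>, consists of \<open>n\<close> letters \<open>j mod 2\<close>, and is
    followed by the other letter, so its length is exactly \<open>n\<close>.\<close>
  have main: "(\<forall>i<n. \<alpha> (n * j + i) = j mod 2) \<and> \<alpha> (n * j + n) = Suc j mod 2 \<and>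
      block_start (j mod 2) \<alpha> (n * j)" for j
  proof (induction j)
    case 0
    then show ?case using zeros one n by (auto simp: block_start_def)
  next
    case (Suc j)
    define x where "x = j mod 2"
    have x: "x \<in> {0, 1}" "Suc j mod 2 = 1 - x" "Suc (Suc j) mod 2 = x"
      by (auto simp: x_def mod_Suc)
    have "\<alpha> \<in> balanced_words x" using bal x(1) by auto
    then obtain l where l: "balanced_block x \<alpha> (n * j) l"
      using Suc by (auto simp: balanced_words_def x_def)
    have xs: "\<alpha> (n * j + i) = x" if "i < n" for i
      using Suc that by (simp add: x_def)
    have y: "\<alpha> (n * j + n) = 1 - x"
      using Suc x(2) by simp
    have "\<not> l < n"
      using xs[of l] l unfolding balanced_block_def by (auto dest!: spec[of _ 0])
    moreover have "\<not> n < l"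
      using y x(1) l unfolding balanced_block_def by (auto dest!: spec[of _ n])
    ultimately have "l = n" by simp
    then have ys: "\<alpha> (n * Suc j + i) = 1 - x" if "i < n" for i
      using l that two[of "n * Suc j + i"] x(1)
      by (auto simp: balanced_block_def algebra_simps)
    have "n * Suc j + n = n * j + 2 * n" by simp
    then have last: "\<alpha> (n * Suc j + n) = x"
      using l \<open>l = n\<close> by (metis balanced_block_def)
    have "n * Suc j - 1 = n * j + (n - 1)" using n by simp
    then have "\<alpha> (n * Suc j - 1) = x" using xs[of "n - 1"] n by simp
    then have "block_start (1 - x) \<alpha> (n * Suc j)"
      using ys[of 0] n x(1) by (auto simp: block_start_def)
    then show ?case using ys last x by simp
  qed
  show ?thesis
  proof
    fix k
    have "k mod n < n" using n by simp
    then have "\<alpha> (n * (k div n) + k mod n) = (k div n) mod 2"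
      using main[of "k div n"] by blast
    then show "\<alpha> k = square_wave n k" by (simp add: square_wave_def)
  qed
qed

text \<open>As \<open>i > n\<close>, the prefix contains the whole first block and the letter after
  it, so the spliced word must be \<open>square_wave n\<close>. Its tail is also a tail of
  \<open>square_wave m\<close>, whose blocks are too long when \<open>n < m\<close>.\<close>

lemma square_wave_splice:
  assumes mem: "prefix i (square_wave n) \<frown> suffix j (square_wave m) \<in>
      omega_words {0, 1} \<inter> balanced_words 0 \<inter> balanced_words 1"
    and n: "n \<ge> 1" "i > n"
  shows "\<not> n < m"
proof
  let ?\<alpha> = "prefix i (square_wave n) \<frown> suffix j (square_wave m)"
  assume less: "n < m"
  have init: "?\<alpha> k = square_wave n k" if "k < i" for k
    using that by simp
  have "?\<alpha> = square_wave n"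
  proof (rule balanced_eq_square_wave)
    show "?\<alpha> k = 0" if "k < n" for k
      using init[of k] that n by (simp add: square_wave_def)
    show "?\<alpha> n = 1"
      using init[of n] n by (simp add: square_wave_def)
  qed (use mem n in auto)
  moreover have "?\<alpha> (i + t) = square_wave m (j + t)" for t by simp
  ultimately have eq: "square_wave n (i + t) = square_wave m (j + t)" for t by metis
  \<comment> \<open>Chosen so that \<open>j + t = m * j\<close> is a block boundary of
    \<open>square_wave m\<close>. From there a shift by \<open>n < m\<close> stays within one block,
    whereas in \<open>square_wave n\<close> a shift by \<open>n\<close> always flips the
    letter.\<close>
  define t where "t = (m - 1) * j"
  have t: "j + t = m * j + 0" "j + (t + n) = m * j + n"
    using less by (cases m; simp add: t_def)+
  have "square_wave m (j + t) = square_wave m (j + (t + n))"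
    using square_wave_mult[of 0 m j] square_wave_mult[of n m j] less unfolding t by simp
  then have "square_wave n (i + t) = square_wave n (i + t + n)"
    using eq[of t] eq[of "t + n"] by (simp add: add.assoc)
  then show False
    using square_wave_add[OF n(1), of "i + t"] by simp
qed

lemma intersection_not_in_class:
  "omega_words {0, 1 :: nat} \<inter> balanced_words 0 \<inter> balanced_words 1 \<notin> det_strong_reset_languages \<Sigma>"
    (is "?L \<notin> _")
proof
  assume "?L \<in> det_strong_reset_languages \<Sigma>"
  then obtain R where R: "finite R"
    "\<And>\<alpha> m. \<alpha> \<in> ?L \<Longrightarrow> \<exists>k>m. {x. prefix k \<alpha> \<frown> x \<in> ?L} \<in> R"
    using finitely_many_residuals_at_resets by blast
  have wave: "square_wave n \<in> ?L" if "n \<ge> 1" for n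
    using square_wave_balanced[OF that] square_wave_omega by simp
  define res where "res n k = {x. prefix k (square_wave n) \<frown> x \<in> ?L}" for n k
  have "\<exists>k>n. res n k \<in> R" if "n \<ge> 1" for n
    using R(2)[OF wave[OF that]] unfolding res_def by blast
  \<comment> \<open>A reset of each wave after its first block is complete; the bound
    \<open>f n > n\<close> is what the splicing argument requires.\<close>
  then obtain f where f: "\<And>n. n \<ge> 1 \<Longrightarrow> f n > n \<and> res n (f n) \<in> R"
    by metis
  have "finite ((\<lambda>n. res n (f n)) ` {1..})"
    using R(1) by (rule finite_subset[rotated]) (use f in auto)
  then have "\<not> inj_on (\<lambda>n. res n (f n)) {1..}"
    using finite_imageD infinite_Ici by blast
  then obtain n m where nm: "n \<ge> 1" "n < m" "res n (f n) = res m (f m)"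
    unfolding inj_on_def by (metis atLeast_iff linorder_neqE_nat)
  \<comment> \<open>The rest of wave \<open>m\<close> lies in the shared residual, so it may also
    continue the prefix of wave \<open>n\<close>.\<close>
  have "suffix (f m) (square_wave m) \<in> res m (f m)"
    using wave[of m] nm by (simp add: res_def)
  then have "prefix (f n) (square_wave n) \<frown> suffix (f m) (square_wave m) \<in> ?L"
    unfolding nm(3)[symmetric] by (simp add: res_def)
  then show False
    using square_wave_splice nm f by blast
qed

section \<open>Union and complement\<close>

lemma union_not_in_class:
  "{\<lambda>_. 0} \<union> (omega_words {0, 1} \<inter> balanced_words (0 :: nat)) \<notin> det_strong_reset_languages \<Sigma>"
proof (rule not_in_class_if_counts_zeros[where b = True])
  fix m n :: nat
  assume mn: "m \<ge> 1" "n \<ge> 1"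
  then have "two_run_word m n m \<noteq> 0" by (simp add: two_run_word_def)
  then have "two_run_word m n \<noteq> (\<lambda>_. 0)" by metis
  then show "two_run_word m n \<in> {\<lambda>_. 0} \<union> (omega_words {0, 1} \<inter> balanced_words 0) \<longleftrightarrow>
      (m = n \<longleftrightarrow> True)"
    using two_run_word_balanced_iff[OF mn] two_run_word_omega by simp
qed simp

lemma complement_not_in_class:
  "omega_words {0, 1} - (omega_words {0, 1} \<inter> balanced_words (0 :: nat)) \<notin>
     det_strong_reset_languages \<Sigma>"
proof (rule not_in_class_if_counts_zeros[where b = False])
  show "(\<lambda>_. 0) \<in> omega_words {0, 1} - (omega_words {0, 1} \<inter> balanced_words (0 :: nat))"
    using zero_word_not_balanced by (auto simp: omega_words_def)
  fix m n :: nat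
  assume "m \<ge> 1" "n \<ge> 1"
  then show "two_run_word m n \<in> omega_words {0, 1} - (omega_words {0, 1} \<inter> balanced_words 0) \<longleftrightarrow>
      (m = n \<longleftrightarrow> False)"
    using two_run_word_balanced_iff two_run_word_omega by simp
qed

theorem lemma6:
  shows
    "(\<exists>\<Sigma> :: nat set. finite \<Sigma> \<and> \<Sigma> \<noteq> {} \<and>
        (\<exists>L\<^sub>1 \<in> det_strong_reset_languages \<Sigma>. \<exists>L\<^sub>2 \<in> det_strong_reset_languages \<Sigma>.
           L\<^sub>1 \<union> L\<^sub>2 \<notin> det_strong_reset_languages \<Sigma>)) \<and>
     (\<exists>\<Sigma> :: nat set. finite \<Sigma> \<and> \<Sigma> \<noteq> {} \<and>
        (\<exists>L\<^sub>1 \<in> det_strong_reset_languages \<Sigma>. \<exists>L\<^sub>2 \<in> det_strong_reset_languages \<Sigma>.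
           L\<^sub>1 \<inter> L\<^sub>2 \<notin> det_strong_reset_languages \<Sigma>)) \<and>
     (\<exists>\<Sigma> :: nat set. finite \<Sigma> \<and> \<Sigma> \<noteq> {} \<and>
        (\<exists>L \<in> det_strong_reset_languages \<Sigma>.
           omega_words \<Sigma> - L \<notin> det_strong_reset_languages \<Sigma>))"
proof (intro conjI exI[of _ "{0, 1 :: nat}"])
  let ?\<Sigma> = "{0, 1 :: nat}"
  let ?C = "det_strong_reset_languages ?\<Sigma>"
  let ?B = "\<lambda>x. omega_words ?\<Sigma> \<inter> balanced_words x"
  show "\<exists>L\<^sub>1\<in>?C. \<exists>L\<^sub>2\<in>?C. L\<^sub>1 \<union> L\<^sub>2 \<notin> ?C"
    using singleton_zero_word_in_class balanced_language_in_class union_not_in_class by blast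
  have inter: "?B 0 \<inter> ?B 1 = omega_words ?\<Sigma> \<inter> balanced_words 0 \<inter> balanced_words 1"
    by blast
  have "?B 0 \<inter> ?B 1 \<notin> ?C"
    using intersection_not_in_class[of ?\<Sigma>] unfolding inter .
  then show "\<exists>L\<^sub>1\<in>?C. \<exists>L\<^sub>2\<in>?C. L\<^sub>1 \<inter> L\<^sub>2 \<notin> ?C"
    using balanced_language_in_class by blast
  show "\<exists>L\<in>?C. omega_words ?\<Sigma> - L \<notin> ?C"
    using balanced_language_in_class complement_not_in_class by blast
qed auto

end
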